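(* Let $r,D\ge 1$ be integers, let $b_1,\dots,b_{rD}\in\mathbb R$, and for $1\le j\le r$ let $$\Phi_j(x)=b_1\frac{B_j(x)}{j}+b_2\frac{B_{j+1}(x)}{j+1}+\cdots+b_{rD}\frac{B_{rD+j-1}(x)}{rD+j-1}.$$ Assume that $\Phi_j(0)=\Phi_j\left(\frac1D\right)=\cdots=\Phi_j\left(\frac{D-1}{D}\right)=0$ for all $1\le j\le r$. Then there exists a polynomial $Q\in\mathbb R[x]$ of degree $\le r-1$ such that, for all $1\le j\le r$, $$\Phi_j(x)=A_{j,0}(x)S(x)+A_{j,1}(x)S(x+1)+\cdots+A_{j,r-1}(x)S(x+r-1),$$ where $S(x)=(Dx)_{Dr}\,Q(x)$ and $$A_{j,\ell}(x)=(-1)^{r-1}\sum_{t=0}^{\ell}(-1)^t\binom rt(x+\ell-t)^{j-1},\quad 1\le j\le r,\ 0\le \ell\le r-1.$$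
   Context: The Bernoulli polynomials $B_n(x)$ are defined by $\frac{ze^{xz}}{e^z-1}=\sum_{n\ge 0}B_n(x)\frac{z^n}{n!}$. The falling factorial is $(y)_N=y(y-1)\cdots(y-N+1)$, so $(Dx)_{Dr}=Dx(Dx-1)\cdots(Dx-Dr+1)$. The zero polynomial is allowed for $Q$; for $j=1$ the factor $(x+\ell-t)^{0}$ is the constant $1$. *)

theory Defs
  imports "HOL-Analysis.Analysis" "HOL-Computational_Algebra.Computational_Algebra"
begin

text \<open>
  The value at \<open>x\<close> of the \<open>n\<close>-th Bernoulli polynomial, read off from the formal power series
  \<open>z e\<^sup>x\<^sup>z / (e\<^sup>z - 1)\<close> in \<open>z\<close>. The denominator has zero constant coefficient; the series division
  is nevertheless exact, as \<open>bernpoly_generating_function\<close> confirms.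
\<close>
definition bernpoly :: "nat \<Rightarrow> real \<Rightarrow> real" where
  "bernpoly n x = fact n * fps_nth (fps_X * fps_exp x / (fps_exp 1 - 1)) n"

lemma bernpoly_generating_function:
  "Abs_fps (\<lambda>n. bernpoly n x / fact n) * (fps_exp 1 - 1) = fps_X * fps_exp x"
proof -
  have "subdegree (fps_exp 1 - 1 :: real fps) = 1"
    by (rule subdegreeI) auto
  moreover from this have "fps_exp 1 - 1 \<noteq> (0 :: real fps)"
    by (metis subdegree_0 zero_neq_one)
  moreover have "subdegree (fps_X * fps_exp x :: real fps) = 1"
    by (rule subdegreeI) auto
  moreover have "fps_X * fps_exp x \<noteq> (0 :: real fps)"
    by (metis fps_X_neq_zero fps_exp_neq_0 mult_eq_0_iff)
  ultimately have "(fps_exp 1 - 1 :: real fps) dvd fps_X * fps_exp x"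
    by (simp add: fps_dvd_iff)
  moreover have "Abs_fps (\<lambda>n. bernpoly n x / fact n) = fps_X * fps_exp x / (fps_exp 1 - 1)"
    by (rule fps_ext) (simp add: bernpoly_def)
  ultimately show ?thesis
    by simp
qed

definition falling_fact :: "real \<Rightarrow> nat \<Rightarrow> real" where
  "falling_fact y N = (\<Prod>i<N. y - real i)"

text \<open>
  Only \<open>b 1, \<dots>, b (r * D)\<close> are used.
\<close>
definition Phi :: "nat \<Rightarrow> nat \<Rightarrow> (nat \<Rightarrow> real) \<Rightarrow> nat \<Rightarrow> real \<Rightarrow> real" where
  "Phi r D b j x = (\<Sum>k = 1..r * D. b k * (bernpoly (k + j - 1) x / real (k + j - 1)))"

definition S_fun :: "nat \<Rightarrow> nat \<Rightarrow> real poly \<Rightarrow> real \<Rightarrow> real" where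
  "S_fun r D Q x = falling_fact (real D * x) (D * r) * poly Q x"

definition A_coef :: "nat \<Rightarrow> nat \<Rightarrow> nat \<Rightarrow> real \<Rightarrow> real" where
  "A_coef r j l x =
     (-1) ^ (r - 1) * (\<Sum>t = 0..l. (-1) ^ t * real (r choose t) * (x + real l - real t) ^ (j - 1))"

end

theory Submission
  imports Defs
begin

text \<open>
  Put \<open>P(x) = \<Sum>\<^sub>k b\<^sub>k x\<^sup>k\<^sup>-\<^sup>1\<close>. Then \<open>\<Phi>\<^sub>j(x + 1) - \<Phi>\<^sub>j(x) = x\<^sup>j\<^sup>-\<^sup>1 P(x)\<close>. Choose a polynomial \<open>S\<close> of degree at
  most \<open>deg P + r\<close> whose \<open>r\<close>-th difference is \<open>P\<close> and which vanishes at \<open>0, \<dots>, r - 1\<close>. By summation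
  by parts, \<open>\<Psi>\<^sub>j(x) = \<Sum>\<^sub>l A\<^sub>j\<^sub>,\<^sub>l(x) S(x + l)\<close> has the same difference as \<open>\<Phi>\<^sub>j\<close>, and both vanish at \<open>0\<close>,
  so \<open>\<Phi>\<^sub>j = \<Psi>\<^sub>j\<close>. For fixed \<open>x\<close> the matrix \<open>A\<^sub>j\<^sub>,\<^sub>l(x)\<close> is a Vandermonde matrix times a unitriangular one,
  hence invertible, so the remaining hypotheses \<open>\<Phi>\<^sub>j(i/D) = 0\<close> force \<open>S(i/D + l) = 0\<close> for all
  \<open>0 \<le> l < r\<close>: the polynomial \<open>(Dx)\<^sub>D\<^sub>r\<close> divides \<open>S\<close>.
\<close>

section \<open>Roots of real polynomials and Vandermonde systems\<close>

lemma periodic_poly_const: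
  fixes p :: "real poly"
  assumes "\<And>x. poly p (x + 1) = poly p x"
  shows "poly p x = poly p 0"
proof -
  have nat: "poly p (real n) = poly p 0" for n
    by (induction n) (simp_all add: add.commute[of 1] assms)
  \<comment> \<open>Periodicity forces \<open>p\<close> minus its value at 0 to vanish at every
    natural number, too many roots for a nonzero polynomial.\<close>
  have "range real \<subseteq> {x. poly (p - [:poly p 0:]) x = 0}"
    using nat by auto
  moreover have "infinite (range real)"
    by (simp add: infinite_UNIV_nat finite_image_iff inj_on_def)
  ultimately have "p - [:poly p 0:] = 0"
    using poly_roots_finite finite_subset by blast
  then have "p = [:poly p 0:]" by simp
  then show ?thesis by (metis poly_const_conv)
qed

lemma linear_factors_dvd:
  fixes p :: "'a::field poly"
  assumes "finite A" "\<And>a. a \<in> A \<Longrightarrow> poly p a = 0"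
  shows "(\<Prod>a\<in>A. [:-a, 1:]) dvd p"
  using assms
proof (induction A rule: finite_induct)
  case (insert a A)
  then obtain q where q: "p = (\<Prod>a\<in>A. [:-a, 1:]) * q"
    by (auto elim: dvdE)
  have "poly (\<Prod>a\<in>A. [:-a, 1:]) a \<noteq> 0"
    using insert.hyps by (auto simp: poly_prod)
  with insert.prems[of a] q have "poly q a = 0" by simp
  then have "[:-a, 1:] dvd q" by (simp add: poly_eq_0_iff_dvd)
  then show ?case
    using insert.hyps q by (metis mult.commute mult_dvd_mono dvd_refl prod.insert)
qed simp

text \<open>Combining the equations with the coefficients of the polynomial that vanishes at all
  nodes except \<open>a m\<close> isolates \<open>w m\<close>. Its degree is r - 1, so only the
  given equations are used.\<close>

lemma vandermonde_kernel:
  fixes a :: "nat \<Rightarrow> real"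
  assumes inj: "inj_on a {..<r}"
    and zero: "\<And>j. j < r \<Longrightarrow> (\<Sum>m<r. a m ^ j * w m) = 0"
    and "m < r"
  shows "w m = 0"
proof -
  define p where "p = (\<Prod>k\<in>{..<r} - {m}. [:-a k, 1:])"
  have "degree p = (\<Sum>k\<in>{..<r} - {m}. degree [:-a k, 1:])"
    unfolding p_def by (rule degree_prod_eq_sum_degree) auto
  also have "\<dots> = r - 1" using \<open>m < r\<close> by simp
  finally have deg: "degree p < r" using \<open>m < r\<close> by simp
  have "(\<Sum>k<r. poly p (a k) * w k) = (\<Sum>k<r. \<Sum>i\<le>degree p. coeff p i * (a k ^ i * w k))"
    by (simp add: poly_altdef sum_distrib_right mult.assoc)
  also have "\<dots> = (\<Sum>i\<le>degree p. coeff p i * (\<Sum>k<r. a k ^ i * w k))"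
    by (subst sum.swap) (simp add: sum_distrib_left)
  also have "\<dots> = 0" using zero deg by (intro sum.neutral) auto
  finally have "(\<Sum>k<r. poly p (a k) * w k) = 0" .
  moreover have "poly p (a k) = 0" if "k < r" "k \<noteq> m" for k
    using that by (auto simp: p_def poly_prod)
  then have "(\<Sum>k<r. poly p (a k) * w k) = (\<Sum>k<r. if k = m then poly p (a m) * w m else 0)"
    by (intro sum.cong) auto
  moreover have "poly p (a m) \<noteq> 0"
    using inj \<open>m < r\<close> by (auto simp: p_def poly_prod inj_on_def)
  ultimately show ?thesis using \<open>m < r\<close> by simp
qed

section \<open>Alternating differences: (-1)^r times the r-th forward difference\<close>

definition alt_diff :: "nat \<Rightarrow> (real \<Rightarrow> real) \<Rightarrow> real \<Rightarrow> real" where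
  "alt_diff r f x = (\<Sum>t\<le>r. (-1) ^ t * real (r choose t) * f (x + real t))"

text \<open>Pascal's rule. The single difference is applied to \<open>f\<close> first, so an
  induction on \<open>r\<close> can continue with a simpler function.\<close>

lemma alt_diff_Suc: "alt_diff (Suc r) f x = alt_diff r (\<lambda>y. f y - f (y + 1)) x"
proof -
  have "alt_diff (Suc r) f x =
    f x + (\<Sum>t\<le>r. (-1) ^ Suc t * real (Suc r choose Suc t) * f (x + real (Suc t)))"
    unfolding alt_diff_def by (subst sum.atMost_Suc_shift) simp
  also have "\<dots> = f x + (\<Sum>t\<le>r. (-1) ^ Suc t * real (r choose Suc t) * f (x + real (Suc t)))
      - (\<Sum>t\<le>r. (-1) ^ t * real (r choose t) * f (x + real (Suc t)))"
    by (simp add: sum.distrib[symmetric] sum_subtractf[symmetric] algebra_simps sum_negf)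
  also have "f x + (\<Sum>t\<le>r. (-1) ^ Suc t * real (r choose Suc t) * f (x + real (Suc t))) =
      (\<Sum>t\<le>Suc r. (-1) ^ t * real (r choose t) * f (x + real t))"
    by (subst sum.atMost_Suc_shift) simp
  also have "\<dots> = alt_diff r f x" by (simp add: alt_diff_def)
  finally show ?thesis
    by (simp add: alt_diff_def sum_subtractf[symmetric] algebra_simps)
qed

lemma alt_diff_sum:
  "alt_diff r (\<lambda>y. \<Sum>k\<in>A. c k * f k y) x = (\<Sum>k\<in>A. c k * alt_diff r (f k) x)"
  unfolding alt_diff_def
  by (simp add: sum_distrib_left mult.assoc mult.left_commute sum.swap[of _ A])

text \<open>One difference turns y^n into a combination of lower powers, so r > n differences
  annihilate it.\<close>

lemma alt_diff_power: "n < r \<Longrightarrow> alt_diff r (\<lambda>y. y ^ n) x = 0"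
proof (induction r arbitrary: n)
  case (Suc r)
  have "(\<lambda>y::real. y ^ n - (y + 1) ^ n) = (\<lambda>y. \<Sum>k<n. - real (n choose k) * y ^ k)"
  proof
    fix y :: real
    have "(y + 1) ^ n = (\<Sum>k\<le>n. real (n choose k) * y ^ k)"
      by (simp add: binomial_ring)
    also have "\<dots> = (\<Sum>k<n. real (n choose k) * y ^ k) + y ^ n"
      by (simp add: lessThan_Suc_atMost[symmetric])
    finally show "y ^ n - (y + 1) ^ n = (\<Sum>k<n. - real (n choose k) * y ^ k)"
      by (simp add: sum_negf)
  qed
  then have "alt_diff (Suc r) (\<lambda>y. y ^ n) x
      = (\<Sum>k<n. - real (n choose k) * alt_diff r (\<lambda>y. y ^ k) x)"
    by (simp only: alt_diff_Suc alt_diff_sum)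
  also have "\<dots> = 0" using Suc by (intro sum.neutral) auto
  finally show ?case .
qed simp

section \<open>Bernoulli polynomials as polynomials, and antidifferences\<close>

definition bern_poly :: "nat \<Rightarrow> real poly" where
  "bern_poly n = (\<Sum>i\<le>n. monom (fact n * (bernpoly i 0 / fact i) / fact (n - i)) (n - i))"

lemma degree_bern_poly: "degree (bern_poly n) \<le> n"
  unfolding bern_poly_def
  by (intro degree_sum_le) (auto intro: order.trans[OF degree_monom_le])

lemma fps_exp_1_minus_1_nonzero: "fps_exp 1 - 1 \<noteq> (0 :: real fps)"
proof
  assume "fps_exp 1 - 1 = (0 :: real fps)"
  then have "fps_nth (fps_exp 1 - 1 :: real fps) 1 = 0" by simp
  then show False by simp
qed

lemma poly_bern_poly: "poly (bern_poly n) x = bernpoly n x"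
proof -
  let ?B = "\<lambda>x. Abs_fps (\<lambda>n. bernpoly n x / fact n)"
  \<comment> \<open>Both sides are z e^(xz) (the generating function at 0 supplies z). After
    cancelling e^z - 1, the Cauchy product yields exactly the coefficients in
    \<open>bern_poly\<close>.\<close>
  have "?B x * (fps_exp 1 - 1) = (?B 0 * fps_exp x) * (fps_exp 1 - 1)"
    using bernpoly_generating_function[of x] bernpoly_generating_function[of 0]
    by (simp add: mult.assoc mult.commute mult.left_commute)
  then have "?B x = ?B 0 * fps_exp x"
    using fps_exp_1_minus_1_nonzero by simp
  then have "fps_nth (?B x) n = fps_nth (?B 0 * fps_exp x) n" by simp
  then have "bernpoly n x / fact n = (\<Sum>i\<le>n. bernpoly i 0 / fact i * (x ^ (n - i) / fact (n - i)))"
    by (simp only: fps_mult_nth fps_exp_nth fps_nth_Abs_fps of_nat_fact atLeast0AtMost)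
  then have "bernpoly n x = fact n * (\<Sum>i\<le>n. bernpoly i 0 / fact i * (x ^ (n - i) / fact (n - i)))"
    by (simp add: divide_eq_eq mult.commute)
  then show ?thesis
    by (simp add: bern_poly_def poly_sum poly_monom sum_distrib_left mult.assoc)
qed

text \<open>Replacing x by x + 1 multiplies z e^(xz) by e^z, so e^z - 1 cancels from the difference
  of the generating functions and z e^(xz) remains.\<close>

lemma bernpoly_diff:
  assumes "n \<ge> 1"
  shows "bernpoly n (x + 1) - bernpoly n x = real n * x ^ (n - 1)"
proof -
  let ?B = "\<lambda>x. Abs_fps (\<lambda>n. bernpoly n x / fact n)"
  have "(?B (x + 1) - ?B x) * (fps_exp 1 - 1) = (fps_X * fps_exp x) * (fps_exp 1 - 1)"
    using bernpoly_generating_function[of x] bernpoly_generating_function[of "x + 1"]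
    by (simp add: fps_exp_add_mult algebra_simps)
  then have "?B (x + 1) - ?B x = fps_X * fps_exp x"
    using fps_exp_1_minus_1_nonzero by simp
  then have "fps_nth (?B (x + 1) - ?B x) n = fps_nth (fps_X * fps_exp x) n" by simp
  then have "bernpoly n (x + 1) / fact n - bernpoly n x / fact n = x ^ (n - 1) / fact (n - 1)"
    using assms by simp
  moreover have "bernpoly n (x + 1) - bernpoly n x =
      fact n * (bernpoly n (x + 1) / fact n - bernpoly n x / fact n)"
    by (simp add: right_diff_distrib)
  moreover have "fact n = real n * fact (n - 1)"
    using assms by (simp add: fact_reduce)
  ultimately show ?thesis by simp
qed

text \<open>B_(i+1)(x)/(i+1) is an antidifference of x^i; subtracting a constant normalises the
  value at 0.\<close>

lemma antidifference_exists:
  fixes p :: "real poly"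
  shows "\<exists>q. degree q \<le> degree p + 1 \<and> poly q 0 = 0 \<and>
    (\<forall>x. poly q (x + 1) - poly q x = poly p x)"
proof -
  define q0 where "q0 = (\<Sum>i\<le>degree p. smult (coeff p i / real (Suc i)) (bern_poly (Suc i)))"
  have "degree q0 \<le> degree p + 1"
    unfolding q0_def
    by (intro degree_sum_le)
      (auto intro!: order.trans[OF degree_smult_le] order.trans[OF degree_bern_poly])
  moreover have "poly q0 (x + 1) - poly q0 x = poly p x" for x
  proof -
    have "poly q0 (x + 1) - poly q0 x = (\<Sum>i\<le>degree p.
        coeff p i / real (Suc i) * (bernpoly (Suc i) (x + 1) - bernpoly (Suc i) x))"
      by (simp add: q0_def poly_sum poly_bern_poly sum_subtractf right_diff_distrib)
    also have "\<dots> = poly p x"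
      by (simp add: bernpoly_diff poly_altdef del: of_nat_Suc)
    finally show ?thesis .
  qed
  ultimately show ?thesis
    by (intro exI[of _ "q0 - [:poly q0 0:]"]) (auto intro!: degree_diff_le)
qed

text \<open>Each antidifference with value 0 at 0 gains one more zero, because s(n+1) = s(n) + q(n).
  The sign arises because \<open>alt_diff\<close> takes f(y) - f(y + 1).\<close>

lemma iterated_antidifference_exists:
  fixes p :: "real poly"
  shows "\<exists>q. degree q \<le> degree p + r \<and> (\<forall>n<r. poly q (real n) = 0) \<and>
    (\<forall>x. alt_diff r (poly q) x = (-1) ^ r * poly p x)"
proof (induction r)
  case 0
  show ?case by (rule exI[of _ p]) (simp add: alt_diff_def)
next
  case (Suc r)
  then obtain q where q: "degree q \<le> degree p + r" "\<And>n. n < r \<Longrightarrow> poly q (real n) = 0"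
    "\<And>x. alt_diff r (poly q) x = (-1) ^ r * poly p x"
    by blast
  obtain s where s: "degree s \<le> degree q + 1" "poly s 0 = 0"
    "\<And>x. poly s (x + 1) - poly s x = poly q x"
    using antidifference_exists by blast
  have "poly s (real n) = 0" if "n \<le> r" for n
    using that
  proof (induction n)
    case (Suc n)
    then show ?case using s(3)[of "real n"] q(2)[of n] by (simp add: add.commute)
  qed (simp add: s)
  moreover have "alt_diff (Suc r) (poly s) x = (-1) ^ Suc r * poly p x" for x
  proof -
    have "(\<lambda>y. poly s y - poly s (y + 1)) = (\<lambda>y. - poly q y)"
      using s(3) by (auto simp: fun_eq_iff algebra_simps)
    then have "alt_diff (Suc r) (poly s) x = - alt_diff r (poly q) x"
      by (simp add: alt_diff_Suc) (simp add: alt_diff_def sum_negf)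
    then show ?thesis using q(3) by simp
  qed
  ultimately show ?case using q(1) s(1) by (intro exI[of _ s]) auto
qed

section \<open>Summation by parts for the sums with \<open>A_coef\<close>, and their
  invertibility\<close>

text \<open>
  The coefficient of \<open>(x + m)\<^sup>j\<^sup>-\<^sup>1\<close> in \<open>\<Sum>\<^sub>l A\<^sub>j\<^sub>,\<^sub>l(x) f(x + l)\<close>, up to the sign \<open>(-1)\<^sup>r\<^sup>-\<^sup>1\<close>.
\<close>
definition tail_sum :: "nat \<Rightarrow> (real \<Rightarrow> real) \<Rightarrow> nat \<Rightarrow> real \<Rightarrow> real" where
  "tail_sum r f m x = (\<Sum>l=m..<r. (-1) ^ (l - m) * real (r choose (l - m)) * f (x + real l))"

text \<open>Substituting m = l - t and exchanging the sums separates the powers, which depend on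
  \<open>j\<close>, from the tail sums, which do not.\<close>

lemma A_coef_sum:
  assumes "r \<ge> 1"
  shows "(\<Sum>l = 0..r - 1. A_coef r j l x * f (x + real l)) =
    (-1) ^ (r - 1) * (\<Sum>m<r. (x + real m) ^ (j - 1) * tail_sum r f m x)"
proof -
  have A: "A_coef r j l x = (-1) ^ (r - 1) *
      (\<Sum>m\<le>l. (-1) ^ (l - m) * real (r choose (l - m)) * (x + real m) ^ (j - 1))" for l
    unfolding A_coef_def atLeast0AtMost
    by (intro arg_cong2[of _ _ _ _ "(*)"] refl sum.reindex_bij_witness[of _ "\<lambda>t. l - t" "\<lambda>t. l - t"])
      (auto simp: of_nat_diff algebra_simps)
  have "(\<Sum>l = 0..r - 1. A_coef r j l x * f (x + real l)) = (-1) ^ (r - 1) * (\<Sum>l<r. \<Sum>m | m \<in> {..<r} \<and> m \<le> l.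
      (-1) ^ (l - m) * real (r choose (l - m)) * (x + real m) ^ (j - 1) * f (x + real l))"
    using assms unfolding A sum_distrib_left sum_distrib_right
    by (intro sum.cong) (auto simp: mult.assoc)
  also have "\<dots> = (-1) ^ (r - 1) * (\<Sum>m<r. \<Sum>l | l \<in> {..<r} \<and> m \<le> l.
      (-1) ^ (l - m) * real (r choose (l - m)) * (x + real m) ^ (j - 1) * f (x + real l))"
    by (subst sum.swap_restrict) auto
  also have "\<dots> = (-1) ^ (r - 1) * (\<Sum>m<r. (x + real m) ^ (j - 1) * tail_sum r f m x)"
    unfolding tail_sum_def sum_distrib_left
    by (intro sum.cong) (auto simp: ac_simps)
  finally show ?thesis .
qed

text \<open>The shift moves the index window from m..r-1 to m+1..r; the new top term l = r is split
  off.\<close>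

lemma tail_sum_shift:
  assumes "m < r"
  shows "tail_sum r f m (x + 1) = tail_sum r f (Suc m) x +
    (-1) ^ (r - Suc m) * real (r choose (r - Suc m)) * f (x + real r)"
proof -
  have "tail_sum r f m (x + 1) =
    (\<Sum>l=Suc m..<Suc r. (-1) ^ (l - Suc m) * real (r choose (l - Suc m)) * f (x + real l))"
    unfolding tail_sum_def sum.shift_bounds_Suc_ivl by (simp add: add.assoc add.commute[of 1])
  then show ?thesis using assms by (simp add: tail_sum_def)
qed

lemma A_coef_sum_diff:
  fixes f :: "real \<Rightarrow> real"
  assumes "1 \<le> j" "j \<le> r"
  defines "\<Psi> \<equiv> \<lambda>x. \<Sum>l = 0..r - 1. A_coef r j l x * f (x + real l)"
  shows "\<Psi> (x + 1) - \<Psi> x = (-1) ^ r * x ^ (j - 1) * alt_diff r f x"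
proof -
  have r: "r \<ge> 1" using assms by simp
  define c where "c t = (-1) ^ t * real (r choose t)" for t
  let ?p = "\<lambda>m. (x + real m) ^ (j - 1)"
  let ?w = "\<lambda>m. tail_sum r f m x"
  have "(\<Sum>m<r. (x + 1 + real m) ^ (j - 1) * tail_sum r f m (x + 1)) =
      (\<Sum>m<r. ?p (Suc m) * (?w (Suc m) + c (r - Suc m) * f (x + real r)))"
    by (intro sum.cong) (auto simp: tail_sum_shift c_def add.assoc)
  \<comment> \<open>Reindexed, the sum runs over 1..r; the term m = 0 is added and
    subtracted.\<close>
  also have "\<dots> = (\<Sum>m\<le>r. ?p m * (?w m + c (r - m) * f (x + real r)))
      - ?p 0 * (?w 0 + c r * f (x + real r))"
    by (cases r) (use r in \<open>simp_all add: sum.atMost_Suc_shift lessThan_Suc_atMost del: sum.atMost_Suc\<close>)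
  also have "(\<Sum>m\<le>r. ?p m * (?w m + c (r - m) * f (x + real r))) =
      (\<Sum>m\<le>r. ?p m * ?w m) + (\<Sum>m\<le>r. ?p m * c (r - m)) * f (x + real r)"
    by (simp add: sum.distrib distrib_left sum_distrib_right mult.assoc)
  \<comment> \<open>The tail sum at m = r is empty.\<close>
  also have "(\<Sum>m\<le>r. ?p m * ?w m) = (\<Sum>m<r. ?p m * ?w m)"
    by (simp add: lessThan_Suc_atMost[symmetric] tail_sum_def)
  \<comment> \<open>The boundary terms form an r-th difference of a power of degree j - 1 < r, hence
    vanish.\<close>
  also have "(\<Sum>m\<le>r. ?p m * c (r - m)) = (-1) ^ r * alt_diff r (\<lambda>y. y ^ (j - 1)) x"
  proof -
    have "c (r - m) = (-1) ^ r * ((-1) ^ m * real (r choose m))" if "m \<le> r" for m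
      using that unfolding c_def
      by (simp add: binomial_symmetric[symmetric] power_diff_conv_inverse flip: power_inverse)
    then show ?thesis
      by (auto simp: alt_diff_def sum_distrib_left intro!: sum.cong)
  qed
  also have "\<dots> = 0" using assms by (simp add: alt_diff_power)
  \<comment> \<open>\<open>?w 0\<close> lacks only the term t = r of the full alternating
    sum.\<close>
  also have "?w 0 + c r * f (x + real r) = alt_diff r f x"
    by (simp add: tail_sum_def alt_diff_def c_def lessThan_Suc_atMost[symmetric] atLeast0LessThan)
  finally have "(\<Sum>m<r. (x + 1 + real m) ^ (j - 1) * tail_sum r f m (x + 1)) =
      (\<Sum>m<r. ?p m * ?w m) - x ^ (j - 1) * alt_diff r f x"
    by simp
  then have "\<Psi> (x + 1) - \<Psi> x = (-1) ^ (r - 1) * (- (x ^ (j - 1) * alt_diff r f x))"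
    unfolding \<Psi>_def A_coef_sum[OF r] by (simp only: right_diff_distrib)
  also have "\<dots> = (-1) ^ r * x ^ (j - 1) * alt_diff r f x"
    using r by (cases r) auto
  finally show ?thesis .
qed

text \<open>The distinct nodes x + m make all tail sums vanish. Back substitution from l = r - 1
  downwards then recovers \<open>f\<close>, since f(x + l) has coefficient 1 in the tail sum
  starting at l.\<close>

lemma A_coef_sum_kernel:
  assumes "r \<ge> 1"
    and "\<And>j. 1 \<le> j \<Longrightarrow> j \<le> r \<Longrightarrow> (\<Sum>l = 0..r - 1. A_coef r j l x * f (x + real l)) = 0"
    and "l < r"
  shows "f (x + real l) = 0"
proof -
  have w: "tail_sum r f m x = 0" if "m < r" for m
  proof (rule vandermonde_kernel[where a = "\<lambda>m. x + real m" and r = r])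
    show "(\<Sum>m<r. (x + real m) ^ j * tail_sum r f m x) = 0" if "j < r" for j
      using assms(2)[of "Suc j"] that unfolding A_coef_sum[OF assms(1)] by simp
  qed (use that in \<open>auto simp: inj_on_def\<close>)
  show ?thesis using \<open>l < r\<close>
  proof (induction "r - l" arbitrary: l rule: less_induct)
    case less
    have "tail_sum r f l x = f (x + real l) +
        (\<Sum>k=Suc l..<r. (-1) ^ (k - l) * real (r choose (k - l)) * f (x + real k))"
      unfolding tail_sum_def using less.prems by (simp add: sum.atLeast_Suc_lessThan)
    also have "\<dots> = f (x + real l)"
      using less by (auto intro!: sum.neutral)
    finally show ?case using w less.prems by simp
  qed
qed

section \<open>Differences and polynomiality of both sides; the falling factorial\<close>

lemma Phi_diff:
  assumes "1 \<le> j"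
  shows "Phi r D b j (x + 1) - Phi r D b j x =
    x ^ (j - 1) * poly (\<Sum>k = 1..r * D. monom (b k) (k - 1)) x"
proof -
  have "Phi r D b j (x + 1) - Phi r D b j x = (\<Sum>k = 1..r * D.
      b k * ((bernpoly (k + j - 1) (x + 1) - bernpoly (k + j - 1) x) / real (k + j - 1)))"
    by (simp add: Phi_def sum_subtractf[symmetric] diff_divide_distrib right_diff_distrib)
  also have "\<dots> = (\<Sum>k = 1..r * D. b k * (x ^ (j - 1) * x ^ (k - 1)))"
  proof (intro sum.cong refl)
    fix k assume "k \<in> {1..r * D}"
    then have "bernpoly (k + j - 1) (x + 1) - bernpoly (k + j - 1) x =
        real (k + j - 1) * (x ^ (j - 1) * x ^ (k - 1))" "real (k + j - 1) \<noteq> 0"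
      using assms bernpoly_diff[of "k + j - 1" x] by (auto simp: power_add[symmetric] add.commute)
    then show "b k * ((bernpoly (k + j - 1) (x + 1) - bernpoly (k + j - 1) x) / real (k + j - 1))
        = b k * (x ^ (j - 1) * x ^ (k - 1))" by simp
  qed
  finally show ?thesis
    by (simp add: poly_sum poly_monom sum_distrib_left ac_simps)
qed

lemma Phi_poly: "\<exists>p. \<forall>x. Phi r D b j x = poly p x"
  by (rule exI[of _ "\<Sum>k = 1..r * D. smult (b k / real (k + j - 1)) (bern_poly (k + j - 1))"])
    (simp add: Phi_def poly_sum poly_bern_poly)

lemma A_coef_sum_poly:
  "\<exists>p. \<forall>x. (\<Sum>l = 0..r - 1. A_coef r j l x * poly s (x + real l)) = poly p x"
proof -
  let ?A = "\<lambda>l. [:(-1) ^ (r - 1):] *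
    (\<Sum>t = 0..l. [:(-1) ^ t * real (r choose t):] * [:real l - real t, 1:] ^ (j - 1))"
  show ?thesis
    by (rule exI[of _ "\<Sum>l = 0..r - 1. ?A l * pcompose s [:real l, 1:]"])
      (simp add: A_coef_def poly_sum poly_pcompose poly_power algebra_simps)
qed

lemma falling_fact_eq_prod:
  assumes "D \<ge> 1"
  shows "falling_fact (real D * x) N = real D ^ N * poly (\<Prod>a\<in>(\<lambda>i. real i / real D) ` {..<N}. [:-a, 1:]) x"
proof -
  have "inj_on (\<lambda>i. real i / real D) {..<N}" using assms by (auto simp: inj_on_def)
  then have "poly (\<Prod>a\<in>(\<lambda>i. real i / real D) ` {..<N}. [:-a, 1:]) x = (\<Prod>i<N. x - real i / real D)"
    by (simp add: prod.reindex poly_prod)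
  then have "real D ^ N * poly (\<Prod>a\<in>(\<lambda>i. real i / real D) ` {..<N}. [:-a, 1:]) x
      = (\<Prod>i<N. real D * (x - real i / real D))"
    by (simp add: prod.distrib)
  then show ?thesis using assms by (simp add: falling_fact_def right_diff_distrib)
qed

theorem theorem2p11:
  fixes r D :: nat and b :: "nat \<Rightarrow> real"
  assumes "r \<ge> 1" and "D \<ge> 1"
    and "\<And>j i. 1 \<le> j \<Longrightarrow> j \<le> r \<Longrightarrow> i < D \<Longrightarrow> Phi r D b j (real i / real D) = 0"
  shows "\<exists>Q :: real poly. degree Q \<le> r - 1 \<and>
    (\<forall>j\<in>{1..r}. \<forall>x. Phi r D b j x = (\<Sum>l = 0..r - 1. A_coef r j l x * S_fun r D Q (x + real l)))"
proof -
  define P where "P = (\<Sum>k = 1..r * D. monom (b k) (k - 1))"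
  have rD: "r * D \<ge> 1" using assms(1,2) by simp
  have degP: "degree P \<le> r * D - 1"
    unfolding P_def
    by (intro degree_sum_le) (auto intro!: order.trans[OF degree_monom_le])
  obtain s where s: "degree s \<le> degree P + r" "\<And>n. n < r \<Longrightarrow> poly s (real n) = 0"
    "\<And>x. alt_diff r (poly s) x = (-1) ^ r * poly P x"
    using iterated_antidifference_exists[of P r] by blast
  define \<Psi> where "\<Psi> j x = (\<Sum>l = 0..r - 1. A_coef r j l x * poly s (x + real l))" for j x
  have Phi_eq: "Phi r D b j x = \<Psi> j x" if j: "1 \<le> j" "j \<le> r" for j x
  proof -
    obtain p q where p: "\<And>x. Phi r D b j x = poly p x" and q: "\<And>x. \<Psi> j x = poly q x"
      using Phi_poly A_coef_sum_poly[of r j s] unfolding \<Psi>_def by metis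
    have "\<Psi> j (x + 1) - \<Psi> j x = Phi r D b j (x + 1) - Phi r D b j x" for x
    proof -
      have "\<Psi> j (x + 1) - \<Psi> j x = ((-1) ^ r * (-1) ^ r) * (x ^ (j - 1) * poly P x)"
        unfolding \<Psi>_def A_coef_sum_diff[OF j] s(3) by (simp only: ac_simps)
      also have "(-1) ^ r * (-1) ^ r = (1 :: real)"
        by (simp flip: power_mult_distrib)
      finally show ?thesis
        by (simp add: Phi_diff[OF j(1)] P_def)
    qed
    \<comment> \<open>Equal differences make p - q periodic, hence constant; the common zero at 0
      then gives p = q.\<close>
    then have "poly (p - q) (x + 1) = poly (p - q) x" for x
      unfolding p q poly_diff by (smt (verit))
    then have "poly (p - q) x = poly (p - q) 0" by (rule periodic_poly_const)
    moreover have "\<Psi> j 0 = 0" unfolding \<Psi>_def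
      using s(2) assms(1) by (auto intro!: sum.neutral)
    moreover have "Phi r D b j 0 = 0" using assms(3)[of j 0] assms(2) j by simp
    ultimately show ?thesis by (simp add: p q)
  qed
  have roots: "poly s (real i / real D) = 0" if "i < D * r" for i
  proof -
    \<comment> \<open>Division with remainder writes i/D as a hypothesis point (i mod D)/D shifted
      by l = i div D < r.\<close>
    have "poly s (real (i mod D) / real D + real (i div D)) = 0"
    proof (rule A_coef_sum_kernel[OF assms(1)])
      show "(\<Sum>l = 0..r - 1. A_coef r j l (real (i mod D) / real D) *
          poly s (real (i mod D) / real D + real l)) = 0" if "1 \<le> j" "j \<le> r" for j
        using assms(3)[OF that, of "i mod D"] Phi_eq[OF that] assms(2) by (simp add: \<Psi>_def)
      show "i div D < r" using that assms(2) by (simp add: div_less_iff_less_mult mult.commute)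
    qed
    moreover have "real (i mod D) / real D + real (i div D) = real i / real D"
    proof -
      have "real i = real (i div D) * real D + real (i mod D)"
        by (metis div_mult_mod_eq of_nat_add of_nat_mult)
      then show ?thesis using assms(2) by (simp add: field_simps)
    qed
    ultimately show ?thesis by simp
  qed
  let ?A = "(\<lambda>i. real i / real D) ` {..<D * r}"
  define F where "F = (\<Prod>a\<in>?A. [:-a, 1:])"
  have "F dvd s" unfolding F_def by (rule linear_factors_dvd) (use roots in auto)
  then obtain q where q: "s = F * q" by (rule dvdE)
  have "degree F = (\<Sum>a\<in>?A. degree [:-a, 1:])"
    unfolding F_def by (rule degree_prod_eq_sum_degree) auto
  also have "\<dots> = card ?A" by simp
  also have "\<dots> = D * r" using assms(2) by (subst card_image) (auto simp: inj_on_def)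
  finally have degF: "degree F = D * r" .
  have degq: "degree q \<le> r - 1"
  proof (cases "q = 0")
    case False
    have "F \<noteq> 0" using degF rD by (auto simp: mult.commute)
    then have "degree s = D * r + degree q" using q False degF by (simp add: degree_mult_eq)
    \<comment> \<open>The degree of \<open>s\<close> is at most (rD - 1) + r, and \<open>F\<close>
      accounts for rD of it.\<close>
    then show ?thesis using s(1) degP rD mult.commute[of r D] by linarith
  qed simp
  \<comment> \<open>\<open>F\<close> is monic, whereas the falling factorial of Dx has leading
    coefficient D^(Dr).\<close>
  define Q where "Q = smult (1 / real D ^ (D * r)) q"
  have "S_fun r D Q x = poly s x" for x
    using assms(2) by (simp add: S_fun_def Q_def falling_fact_eq_prod q F_def)
  then show ?thesis
    using degq Phi_eq by (intro exI[of _ Q]) (auto simp: Q_def \<Psi>_def)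
qed

end
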